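(* Let $\mathcal T$ be any poset, $S$ a finite set of random variables, and $\mathscr A$ a set of affects relations over $S$ containing an affects causal loop of type ACL1, ACL2a, ACL3, ACL4, ACL5, ACL6 or ACL6a. Then there is no (support-)stable embedding of $S$ into $\mathcal T$ compatible with $\mathscr A$.
   Context: Affects relations. Elements of $\mathscr A$ are affects relations $X\models Y\mid\{\mathrm{do}(Z),W\}$ with $X,Y,Z,W\subseteq S$ pairwise disjoint and $X,Y$ non-empty ($X\models Y$ if $Z=W=\emptyset$), some of which are irreducible. (In a causal model, $X\models Y\mid\{\mathrm{do}(Z),W\}$ means $P_{\mathcal G_{\mathrm{do}(X\cup Z)}}(Y|x,z,w)\ne P_{\mathcal G_{\mathrm{do}(Z)}}(Y|z,w)$ for some values, and it is irreducible if $s_X\models Y\mid\{\mathrm{do}(Z\cup(X\setminus s_X)),W\}$ for all non-empty $s_X\subsetneq X$; for this statement only the resulting sets of relations and their irreducibility matter.) Loops. All sets below are non-empty subsets of $S$, and all relations are in $\mathscr A$ and irreducible. A complete affects chain from $S_1$ to $S_n$ ($n\ge2$): sets $S_i\subseteq\hat S_i$ with $\hat S_i\models S_{i+1}$ for all $1\le i<n$. - ACL1: single variables $X,Y$ with $X\models Y$, $Y\models X$. - ACL2a: single variables with $X\models Z_1\models\dots\models Z_k\models Y\models X$ ($k\ge0$). - ACL3: disjoint $S_1,S_2$, $e_1\in S_1$, $e_2\in S_2$ with $S_1\models e_2$ and $S_2\models e_1$. - ACL5: a complete affects chain from some $S_1$ to itself; ACL4: an ACL5 with $S_i=\hat S_i$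 for all $i$. - ACL6: $S_1\models S_2$, and for each $e_2\in S_2$ there are $s_1\subseteq S_1$ and a complete affects chain from $\{e_2\}$ to $s_1$. - ACL6a: Given $S_1$, define inductively (finitely many applications) when a set $T$ returns to $S_1$: for each $e\in T$ there is a complete affects chain from $\{e\}$ either to some $s_1\subseteq S_1$ or to some $T'$ disjoint from $T$ that returns to $S_1$. An ACL6a consists of $S_1,S_2$ with a complete affects chain from $S_1$ to $S_2$ such that $S_2$ returns to $S_1$. Embeddings. A poset $\mathcal T$ is a set with a strict partial order $\prec$ ($\preceq$ its reflexive closure). An embedding of $S$ into $\mathcal T$ assigns to each $X\in S$ a location $O(X)\in\mathcal T$ and an accessible region $\mathcal R_X\subseteq\mathcal T$; for sets, $\mathcal R_X:=\bigcap_{X_i\in X}\mathcal R_{X_i}$. The future of a variable is $\bar{\mathcal F}(X)=\{a\in\mathcal T: a\succeq O(X)\}$ and for a set $X\subseteq S$ the support future is $\bar{\mathcal F}_s(X)=\bigcap_{X_i\in X}\bar{\mathcal F}(X_i)$. The embedding is compatible with $\mathscr A$ if (compat1) $\mathcal R_Y\cap\mathcal R_W\cap\mathcal R_Z\subseteq\mathcal R_X$ for every irreducible $X\models Y\mid\{\mathrm{do}(Z),W\}$ in $\mathscr A$, and (compat2) $\mathcal R_X=\bar{\mathcal F}(X)$ for every $X\in S$. It is (support-)stable if $\bar{\mathcal F}_s(Y\cup Z\cup W)\subsetneq\bar{\mathcal F}_s(X)$ (equality excluded) for every $X\models Y\mid\{\mathrm{do}(Z),W\}$ in $\mathscr A$.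 *)

theory Defs
  imports Main
begin

text \<open>\<open>Affects X Y Z W\<close> stands for \<open>X \<Turnstile> Y | {do(Z), W}\<close>.\<close>

datatype 'v affects = Affects "'v set" "'v set" "'v set" "'v set"

definition affects_relations_over :: "'v set \<Rightarrow> 'v affects set \<Rightarrow> bool" where
  "affects_relations_over S M \<longleftrightarrow>
     (\<forall>X Y Z W. Affects X Y Z W \<in> M \<longrightarrow>
        X \<subseteq> S \<and> Y \<subseteq> S \<and> Z \<subseteq> S \<and> W \<subseteq> S \<and> X \<noteq> {} \<and> Y \<noteq> {} \<and>
        X \<inter> Y = {} \<and> X \<inter> Z = {} \<and> X \<inter> W = {} \<and>
        Y \<inter> Z = {} \<and> Y \<inter> W = {} \<and> Z \<inter> W = {})"

text \<open>Throughout, \<open>M\<close> is the set of all affects relations that hold in the underlying causal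
  model and \<open>A \<subseteq> M\<close> is the given set of affects relations. Irreducibility of a relation is a
  property of the model: the relations it requires must hold (lie in \<open>M\<close>), but need not be listed
  in \<open>A\<close>.\<close>

fun irreducible_affects :: "'v affects set \<Rightarrow> 'v affects \<Rightarrow> bool" where
  "irreducible_affects M (Affects X Y Z W) \<longleftrightarrow>
     Affects X Y Z W \<in> M \<and>
     (\<forall>s. s \<noteq> {} \<longrightarrow> s \<subset> X \<longrightarrow> Affects s Y (Z \<union> (X - s)) W \<in> M)"

definition irr_affects :: "'v affects set \<Rightarrow> 'v affects set \<Rightarrow> 'v set \<Rightarrow> 'v set \<Rightarrow> bool" where
  "irr_affects M A X Y \<longleftrightarrow>
     Affects X Y {} {} \<in> A \<and> irreducible_affects M (Affects X Y {} {})"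


subsection \<open>Affects causal loops\<close>

text \<open>The chain has the sets \<open>C 1, \<dots>, C n\<close> and \<open>H 1, \<dots>, H (n - 1)\<close> (the hatted sets). The
  latter are nonempty subsets of \<open>S\<close> because they occur in affects relations.\<close>

definition is_complete_affects_chain ::
  "'v set \<Rightarrow> 'v affects set \<Rightarrow> 'v affects set \<Rightarrow> nat \<Rightarrow> (nat \<Rightarrow> 'v set) \<Rightarrow> (nat \<Rightarrow> 'v set) \<Rightarrow> bool"
where
  "is_complete_affects_chain S M A n C H \<longleftrightarrow>
     n \<ge> 2 \<and>
     (\<forall>i\<in>{1..n}. C i \<noteq> {} \<and> C i \<subseteq> S) \<and>
     (\<forall>i\<in>{1..<n}. C i \<subseteq> H i \<and> irr_affects M A (H i) (C (Suc i)))"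

definition complete_affects_chain ::
  "'v set \<Rightarrow> 'v affects set \<Rightarrow> 'v affects set \<Rightarrow> 'v set \<Rightarrow> 'v set \<Rightarrow> bool" where
  "complete_affects_chain S M A P Q \<longleftrightarrow>
     (\<exists>n C H. is_complete_affects_chain S M A n C H \<and> C 1 = P \<and> C n = Q)"

definition ACL1 :: "'v affects set \<Rightarrow> 'v affects set \<Rightarrow> bool" where
  "ACL1 M A \<longleftrightarrow> (\<exists>x y. irr_affects M A {x} {y} \<and> irr_affects M A {y} {x})"

definition ACL2a :: "'v affects set \<Rightarrow> 'v affects set \<Rightarrow> bool" where
  "ACL2a M A \<longleftrightarrow>
     (\<exists>x y zs. successively (\<lambda>u v. irr_affects M A {u} {v}) (x # zs @ [y, x]))"

definition ACL3 :: "'v affects set \<Rightarrow> 'v affects set \<Rightarrow> bool" where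
  "ACL3 M A \<longleftrightarrow>
     (\<exists>S1 S2 e1 e2. S1 \<inter> S2 = {} \<and> e1 \<in> S1 \<and> e2 \<in> S2 \<and>
        irr_affects M A S1 {e2} \<and> irr_affects M A S2 {e1})"

definition ACL4 :: "'v set \<Rightarrow> 'v affects set \<Rightarrow> 'v affects set \<Rightarrow> bool" where
  "ACL4 S M A \<longleftrightarrow>
     (\<exists>n C H. is_complete_affects_chain S M A n C H \<and> C n = C 1 \<and> (\<forall>i\<in>{1..<n}. C i = H i))"

definition ACL5 :: "'v set \<Rightarrow> 'v affects set \<Rightarrow> 'v affects set \<Rightarrow> bool" where
  "ACL5 S M A \<longleftrightarrow> (\<exists>S1. complete_affects_chain S M A S1 S1)"

definition ACL6 :: "'v set \<Rightarrow> 'v affects set \<Rightarrow> 'v affects set \<Rightarrow> bool" where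
  "ACL6 S M A \<longleftrightarrow>
     (\<exists>S1 S2. irr_affects M A S1 S2 \<and>
        (\<forall>e2\<in>S2. \<exists>s1\<subseteq>S1. complete_affects_chain S M A {e2} s1))"

inductive returns_to :: "'v set \<Rightarrow> 'v affects set \<Rightarrow> 'v affects set \<Rightarrow> 'v set \<Rightarrow> 'v set \<Rightarrow> bool"
  for S M A S1 where
  "T \<noteq> {} \<Longrightarrow> T \<subseteq> S \<Longrightarrow>
   (\<forall>e\<in>T. (\<exists>s1. s1 \<subseteq> S1 \<and> complete_affects_chain S M A {e} s1) \<or>
           (\<exists>T'. T' \<inter> T = {} \<and> complete_affects_chain S M A {e} T' \<and> returns_to S M A S1 T'))
   \<Longrightarrow> returns_to S M A S1 T"

definition ACL6a :: "'v set \<Rightarrow> 'v affects set \<Rightarrow> 'v affects set \<Rightarrow> bool" where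
  "ACL6a S M A \<longleftrightarrow>
     (\<exists>S1 S2. complete_affects_chain S M A S1 S2 \<and> returns_to S M A S1 S2)"

definition contains_affects_causal_loop ::
  "'v set \<Rightarrow> 'v affects set \<Rightarrow> 'v affects set \<Rightarrow> bool" where
  "contains_affects_causal_loop S M A \<longleftrightarrow>
     ACL1 M A \<or> ACL2a M A \<or> ACL3 M A \<or> ACL4 S M A \<or> ACL5 S M A \<or> ACL6 S M A \<or> ACL6a S M A"


subsection \<open>Embeddings into a poset\<close>

text \<open>An embedding is given by a location map \<open>loc\<close> and accessible regions \<open>R\<close>; only their
  values on \<open>S\<close> are used. Intersections over the empty set of variables are the whole poset.\<close>

definition region :: "('v \<Rightarrow> 'p set) \<Rightarrow> 'v set \<Rightarrow> 'p set" where
  "region R X = (\<Inter>x\<in>X. R x)"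

definition future :: "('v \<Rightarrow> 'p::order) \<Rightarrow> 'v \<Rightarrow> 'p set" where
  "future loc x = {a. a \<ge> loc x}"

definition support_future :: "('v \<Rightarrow> 'p::order) \<Rightarrow> 'v set \<Rightarrow> 'p set" where
  "support_future loc X = (\<Inter>x\<in>X. future loc x)"

definition compatible_embedding ::
  "'v set \<Rightarrow> 'v affects set \<Rightarrow> 'v affects set \<Rightarrow> ('v \<Rightarrow> 'p::order) \<Rightarrow> ('v \<Rightarrow> 'p set) \<Rightarrow> bool" where
  "compatible_embedding S M A loc R \<longleftrightarrow>
     (\<forall>X Y Z W. Affects X Y Z W \<in> A \<longrightarrow> irreducible_affects M (Affects X Y Z W) \<longrightarrow>
        region R Y \<inter> region R W \<inter> region R Z \<subseteq> region R X) \<and>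
     (\<forall>x\<in>S. R x = future loc x)"

definition stable_embedding :: "'v affects set \<Rightarrow> ('v \<Rightarrow> 'p::order) \<Rightarrow> bool" where
  "stable_embedding A loc \<longleftrightarrow>
     (\<forall>X Y Z W. Affects X Y Z W \<in> A \<longrightarrow>
        support_future loc (Y \<union> Z \<union> W) \<subset> support_future loc X)"

end

theory Submission
  imports Defs
begin

text \<open>Stability alone makes the support future shrink strictly along every irreducible relation, and
  it is antitone in the set, so it shrinks strictly along complete affects chains. A set that
  returns to \<open>S1\<close> has, element by element, a support future containing that of \<open>S1\<close>. A loop
  therefore gives a support future that is strictly contained in itself.\<close>

lemma support_future_antimono: "X \<subseteq> Y \<Longrightarrow> support_future loc Y \<subseteq> support_future loc X"
  by (auto simp: support_future_def)

text \<open>Both ACL6 and \<open>returns_to\<close> supply a separate chain for each element; this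
  glues the resulting inclusions into one for the whole set.\<close>

lemma le_support_future_iff:
  "F \<subseteq> support_future loc X \<longleftrightarrow> (\<forall>x\<in>X. F \<subseteq> support_future loc {x})"
  by (auto simp: support_future_def)

context
  fixes A :: "'v affects set" and loc :: "'v \<Rightarrow> 'p::order"
  assumes stable: "stable_embedding A loc"
begin

lemma support_future_irr_affects:
  assumes "irr_affects M A X Y"
  shows "support_future loc Y \<subset> support_future loc X"
proof -
  have "Affects X Y {} {} \<in> A"
    using assms by (simp add: irr_affects_def)
  then have "support_future loc (Y \<union> {} \<union> {}) \<subset> support_future loc X"
    using stable unfolding stable_embedding_def by blast
  then show ?thesis
    by simp
qed

lemma support_future_chain:
  assumes "complete_affects_chain S M A P Q"
  shows "support_future loc Q \<subset> support_future loc P"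
proof -
  obtain n C H where n: "n \<ge> 2" and PQ: "C 1 = P" "C n = Q"
    and CH: "\<forall>i\<in>{1..<n}. C i \<subseteq> H i \<and> irr_affects M A (H i) (C (Suc i))"
    using assms unfolding complete_affects_chain_def is_complete_affects_chain_def by blast
  \<comment> \<open>Strictness comes from the relation out of \<open>H i\<close>; passing from
    \<open>H i\<close> down to its subset \<open>C i\<close> can only enlarge the support
    future.\<close>
  have chain_step: "support_future loc (C (Suc i)) \<subset> support_future loc (C i)" if "1 \<le> i" "i < n" for i
  proof -
    have "C i \<subseteq> H i" "irr_affects M A (H i) (C (Suc i))"
      using CH that by auto
    then show ?thesis
      using support_future_irr_affects support_future_antimono by (meson psubset_subset_trans)
  qed
  \<comment> \<open>The induction starts at 2 because strict inclusion fails at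
    \<open>k = 1\<close>; a chain has \<open>n \<ge> 2\<close>, so its end is reached.\<close>
  have "k \<le> n \<longrightarrow> support_future loc (C k) \<subset> support_future loc (C 1)" if "2 \<le> k" for k
    using that
  proof (induction k rule: dec_induct)
    case base
    then show ?case
      using chain_step[of 1] by (simp add: numeral_2_eq_2)
  next
    case (step k)
    then show ?case
      using chain_step[of k] by (meson Suc_leD Suc_le_lessD le_trans one_le_numeral psubset_trans)
  qed
  then show ?thesis
    using n PQ by blast
qed

text \<open>Induction on the returning derivation. The chain from \<open>{e}\<close> ends in a
  subset of \<open>S1\<close> or in a returning set; by antitonicity or the induction hypothesis,
  the support future of that end contains that of \<open>S1\<close>, and the chain carries this back
  to \<open>{e}\<close>.\<close>

lemma support_future_returns_to:
  assumes "returns_to S M A S1 T"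
  shows "support_future loc S1 \<subseteq> support_future loc T"
  using assms
proof (induction rule: returns_to.induct)
  case (1 T)
  have "support_future loc S1 \<subseteq> support_future loc {e}" if "e \<in> T" for e
    using 1 that support_future_chain support_future_antimono by (meson order_trans psubset_imp_subset)
  then show ?case
    using le_support_future_iff by blast
qed

lemma not_ACL2a: "\<not> ACL2a M A"
proof
  assume "ACL2a M A"
  then obtain x y zs where "successively (\<lambda>u v. irr_affects M A {u} {v}) (x # zs @ [y, x])"
    unfolding ACL2a_def by blast
  then have "successively (\<lambda>u v. support_future loc {v} \<subset> support_future loc {u}) (x # zs @ [y, x])"
    by (rule successively_mono) (use support_future_irr_affects in auto)
  \<comment> \<open>Transitivity extends the comparison of neighbours to all pairs in the list, in
    particular to its first and last entries, which are both \<open>x\<close>.\<close>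
  moreover have "transp (\<lambda>u v. support_future loc {v} \<subset> support_future loc {u})"
    by (rule transpI) blast
  ultimately have "sorted_wrt (\<lambda>u v. support_future loc {v} \<subset> support_future loc {u}) (x # zs @ [y, x])"
    using successively_conv_sorted_wrt by blast
  then show False
    by simp
qed

lemma not_ACL5: "\<not> ACL5 S M A"
  using support_future_chain unfolding ACL5_def by blast

lemma not_contains_affects_causal_loop: "\<not> contains_affects_causal_loop S M A"
proof -
  have "\<not> ACL1 M A"
    using support_future_irr_affects unfolding ACL1_def by blast
  moreover have "\<not> ACL3 M A"
  proof
    assume "ACL3 M A"
    then obtain S1 S2 e1 e2 where "{e1} \<subseteq> S1" "{e2} \<subseteq> S2"
      "irr_affects M A S1 {e2}" "irr_affects M A S2 {e1}"
      unfolding ACL3_def by blast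
    \<comment> \<open>Writing F for the support future, the cycle is F{e2} < F(S1) \<le> F{e1} <
      F(S2) \<le> F{e2}, alternating stability and antitonicity.\<close>
    then show False
      using support_future_irr_affects support_future_antimono by (meson order.trans psubsetE)
  qed
  moreover have "\<not> ACL4 S M A"
    using not_ACL5 unfolding ACL4_def ACL5_def complete_affects_chain_def by blast
  moreover have "\<not> ACL6 S M A"
  proof
    assume "ACL6 S M A"
    then obtain S1 S2 where S12: "irr_affects M A S1 S2"
      and ret: "\<forall>e\<in>S2. \<exists>s1\<subseteq>S1. complete_affects_chain S M A {e} s1"
      unfolding ACL6_def by blast
    \<comment> \<open>The end \<open>s1\<close> of the chain from \<open>{e}\<close> lies in
      \<open>S1\<close>, so its support future contains that of \<open>S1\<close>.\<close>
    have "support_future loc S1 \<subseteq> support_future loc {e}" if "e \<in> S2" for e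
      using ret that support_future_chain support_future_antimono
      by (meson order_trans psubset_imp_subset)
    then have "support_future loc S1 \<subseteq> support_future loc S2"
      using le_support_future_iff by blast
    then show False
      using support_future_irr_affects[OF S12] by blast
  qed
  moreover have "\<not> ACL6a S M A"
    using support_future_chain support_future_returns_to unfolding ACL6a_def by blast
  ultimately show ?thesis
    using not_ACL2a not_ACL5 unfolding contains_affects_causal_loop_def by blast
qed

end

theorem theorem5p10:
  fixes S :: "'v set" and M A :: "'v affects set"
  assumes "finite S"
    and "affects_relations_over S M"
    and "A \<subseteq> M"
    and "contains_affects_causal_loop S M A"
  shows "\<not> (\<exists>(loc :: 'v \<Rightarrow> 'p::order) (R :: 'v \<Rightarrow> 'p set).
            compatible_embedding S M A loc R \<and> stable_embedding A loc)"
  using assms(4) not_contains_affects_causal_loop by blast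

end
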